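(* Let $n\ge 2$, $L\ge 1$ be integers, and let $\Phi_1,\dots,\Phi_L$ be restricted clauses on $n$ qubits, i.e. $\Phi_\alpha=|\phi_\alpha\rangle\langle\phi_\alpha|$ with $|\phi_\alpha\rangle=a_\alpha|01\rangle_{i,j}+b_\alpha|10\rangle_{i,j}$ for each $\alpha$. Let $\epsilon$ be the smallest non-zero eigenvalue of $H=\sum_{\alpha=1}^L\Phi_\alpha$, let $\Pi_0$ be the orthogonal projector onto the ground space $\ker H$, and let $0\le p<1$. Let $\rho_0=\mathbb{1}/2^n$ be the maximally mixed state. Then for every integer $$T\ge\frac{n^2L}{2(1-p)\epsilon},$$ the state $\rho_T=\mathcal{T}^T(\rho_0)$ (the result of applying the map $\mathcal{T}$ $T$ times) satisfies $\mathrm{tr}[\Pi_0\rho_T]>p$.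
   Context: There are $n$ qubits; for each qubit $i$ an orthonormal basis $\{|0\rangle_i,|1\rangle_i\}$ of $\mathbb{C}^2$ is fixed. Each restricted clause $\Phi_\alpha$ acts on two distinct qubits $i,j$ (depending on $\alpha$) and as the identity elsewhere, with $a_\alpha,b_\alpha\in\mathbb{C}$, $|a_\alpha|^2+|b_\alpha|^2=1$. For a clause $\Phi_\alpha$ acting on qubits $i,j$, define the completely positive trace preserving map $$\mathcal{T}_\alpha(\rho)=(\mathbb{1}-\Phi_\alpha)\rho(\mathbb{1}-\Phi_\alpha)+\tfrac12\Lambda_i(\Phi_\alpha\rho\Phi_\alpha)+\tfrac12\Lambda_j(\Phi_\alpha\rho\Phi_\alpha),$$ where $\Lambda_i(\rho)=\int d[U_i]\,U_i\rho U_i^\dagger=\frac{\mathbb{1}_i}{2}\otimes\mathrm{tr}_i[\rho]$ is the Haar twirl on qubit $i$ ($\mathrm{tr}_i$ is the partial trace over qubit $i$). Define $\mathcal{T}(\rho)=\frac1L\sum_{\alpha=1}^L\mathcal{T}_\alpha(\rho)$. *)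

theory Defs
  imports "HOL-Analysis.Analysis"
begin

text \<open>
  The qubits are the elements of a finite type \<open>'n\<close>, so that \<open>n\<close> is \<open>CARD('n)\<close>. An element
  \<open>x :: 'n \<Rightarrow> bool\<close> labels the product basis vector whose factor at qubit \<open>k\<close> is
  \<open>|1\<rangle>\<close> if \<open>x k\<close> holds and \<open>|0\<rangle>\<close> otherwise, with respect to the basis fixed for qubit \<open>k\<close>.
  Operators are matrices in this product basis, the first index being the row.
\<close>

type_synonym 'n operator = "complex ^ ('n \<Rightarrow> bool) ^ ('n \<Rightarrow> bool)"

definition conj_transpose :: "complex ^ 'b ^ 'b \<Rightarrow> complex ^ 'b ^ 'b" where
  "conj_transpose A = (\<chi> x y. cnj (A $ y $ x))"

definition mat_eigenvalue :: "complex ^ 'b ^ 'b \<Rightarrow> complex \<Rightarrow> bool" where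
  "mat_eigenvalue A \<mu> \<longleftrightarrow> (\<exists>v. v \<noteq> 0 \<and> A *v v = \<mu> *s v)"

text \<open>Only used for Hermitian matrices, all of whose eigenvalues are real.\<close>

definition smallest_nonzero_eigenvalue :: "complex ^ 'b ^ 'b \<Rightarrow> real \<Rightarrow> bool" where
  "smallest_nonzero_eigenvalue A e \<longleftrightarrow>
     e \<noteq> 0 \<and> mat_eigenvalue A (complex_of_real e) \<and>
     (\<forall>\<mu>::real. \<mu> \<noteq> 0 \<and> mat_eigenvalue A (complex_of_real \<mu>) \<longrightarrow> e \<le> \<mu>)"

definition mat_kernel :: "complex ^ 'b ^ 'b \<Rightarrow> (complex ^ 'b) set" where
  "mat_kernel A = {v. A *v v = 0}"

definition orthogonal_projector_onto :: "complex ^ 'b ^ 'b \<Rightarrow> (complex ^ 'b) set \<Rightarrow> bool" where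
  "orthogonal_projector_onto P S \<longleftrightarrow>
     P ** P = P \<and> conj_transpose P = P \<and> range (\<lambda>v. P *v v) = S"

text \<open>The amplitudes \<open>\<langle>s t|\<phi>\<rangle>\<close> of the two-qubit vector \<open>|\<phi>\<rangle> = a |01\<rangle> + b |10\<rangle>\<close>.\<close>

definition clause_amp :: "complex \<Rightarrow> complex \<Rightarrow> bool \<Rightarrow> bool \<Rightarrow> complex" where
  "clause_amp a b s t = (if \<not> s \<and> t then a else if s \<and> \<not> t then b else 0)"

text \<open>
  The operator \<open>|\<phi>\<rangle>\<langle>\<phi>|\<close> on qubits \<open>i\<close> and \<open>j\<close>, tensored with the identity on all other
  qubits: the condition in the matrix entry is the entry of that identity.
\<close>

definition clause :: "'n::finite \<Rightarrow> 'n \<Rightarrow> complex \<Rightarrow> complex \<Rightarrow> 'n operator" where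
  "clause i j a b =
     (\<chi> x y. if \<forall>k. k \<noteq> i \<and> k \<noteq> j \<longrightarrow> x k = y k
             then clause_amp a b (x i) (x j) * cnj (clause_amp a b (y i) (y j)) else 0)"

text \<open>
  The Haar twirl on qubit \<open>i\<close>, in its closed form \<open>(1/2) \<otimes> tr\<^sub>i \<rho>\<close>: the sum over \<open>s\<close> is the entry of
  the partial trace (it does not depend on \<open>x i\<close> and \<open>y i\<close>), and the condition \<open>x i = y i\<close>
  together with the factor 1/2 is the entry of the maximally mixed state of qubit \<open>i\<close>.
\<close>

definition twirl :: "'n::finite \<Rightarrow> 'n operator \<Rightarrow> 'n operator" where
  "twirl i \<rho> =
     (\<chi> x y. if x i = y i then (1/2) * (\<Sum>s\<in>UNIV. \<rho> $ (x(i := s)) $ (y(i := s))) else 0)"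

definition clause_channel ::
    "'n::finite \<Rightarrow> 'n \<Rightarrow> 'n operator \<Rightarrow> 'n operator \<Rightarrow> 'n operator" where
  "clause_channel i j \<Phi> \<rho> =
     (mat 1 - \<Phi>) ** \<rho> ** (mat 1 - \<Phi>)
     + (1/2) *\<^sub>R twirl i (\<Phi> ** \<rho> ** \<Phi>)
     + (1/2) *\<^sub>R twirl j (\<Phi> ** \<rho> ** \<Phi>)"

definition hamiltonian ::
    "nat \<Rightarrow> (nat \<Rightarrow> 'n::finite) \<Rightarrow> (nat \<Rightarrow> 'n) \<Rightarrow> (nat \<Rightarrow> complex) \<Rightarrow> (nat \<Rightarrow> complex)
      \<Rightarrow> 'n operator" where
  "hamiltonian L i j a b = (\<Sum>\<alpha>=1..L. clause (i \<alpha>) (j \<alpha>) (a \<alpha>) (b \<alpha>))"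

definition average_channel ::
    "nat \<Rightarrow> (nat \<Rightarrow> 'n::finite) \<Rightarrow> (nat \<Rightarrow> 'n) \<Rightarrow> (nat \<Rightarrow> complex) \<Rightarrow> (nat \<Rightarrow> complex)
      \<Rightarrow> 'n operator \<Rightarrow> 'n operator" where
  "average_channel L i j a b \<rho> =
     (1 / real L) *\<^sub>R
       (\<Sum>\<alpha>=1..L. clause_channel (i \<alpha>) (j \<alpha>) (clause (i \<alpha>) (j \<alpha>) (a \<alpha>) (b \<alpha>)) \<rho>)"

definition maximally_mixed :: "('n::finite) operator" where
  "maximally_mixed = (1 / 2 ^ CARD('n)) *\<^sub>R mat 1"

end

theory Submission
  imports Defs
begin

text \<open>
  Let \<open>M\<close> be the magnetization \<open>\<Sum>\<^sub>k \<plusminus>1/2\<close>, a diagonal operator with \<open>M\<^sup>2 \<le> n\<^sup>2/4\<close>. Every clause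
  commutes with \<open>M\<close>, and a violated clause forces \<open>x i \<noteq> x j\<close>; randomising one of these two qubits
  then moves \<open>M\<close> by \<open>+1\<close>, \<open>0\<close>, \<open>0\<close>, \<open>-1\<close> with equal probabilities. So one step of the channel raises
  the expectation of \<open>M\<^sup>2\<close> by exactly \<open>tr (H \<rho>) / (2 L)\<close>, which is at least
  \<open>\<epsilon> (1 - tr (\<Pi>\<^sub>0 \<rho>)) / (2 L)\<close>. The weight \<open>tr (\<Pi>\<^sub>0 \<rho>\<^sub>t)\<close> never decreases; were it at most \<open>p\<close> at
  time \<open>T\<close>, the expectation of \<open>M\<^sup>2\<close>, positive at the start, would grow beyond \<open>n\<^sup>2/4\<close> by then.
\<close>

section \<open>Spectral gap of a self-adjoint map on a real inner product space\<close>

text \<open>Stepping from \<open>w\<close> by \<open>- t *\<^sub>R f w\<close> changes the quadratic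
  form from 0 to t^2 C - 2 t A with A the squared norm of \<open>f w\<close>. For small positive t
  this would be negative unless A = 0.\<close>

lemma selfadjoint_nonneg_null:
  fixes f :: "'a::real_inner \<Rightarrow> 'a"
  assumes "linear f" and sa: "\<And>x y. x \<bullet> f y = f x \<bullet> y"
    and nonneg: "\<And>x. 0 \<le> x \<bullet> f x" and "w \<bullet> f w = 0"
  shows "f w = 0"
proof (rule ccontr)
  assume "f w \<noteq> 0"
  define A where "A = f w \<bullet> f w"
  define C where "C = f w \<bullet> f (f w)"
  have A: "A > 0" using \<open>f w \<noteq> 0\<close> by (simp add: A_def)
  have C: "C \<ge> 0" unfolding C_def by (rule nonneg)
  have quad: "0 \<le> t\<^sup>2 * C - 2 * t * A" for t :: real
  proof -
    have "0 \<le> (w - t *\<^sub>R f w) \<bullet> f (w - t *\<^sub>R f w)" by (rule nonneg)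
    also have "\<dots> = t\<^sup>2 * C - 2 * t * A"
      using \<open>w \<bullet> f w = 0\<close> sa[of w "f w"] unfolding A_def C_def
      by (simp add: linear_diff[OF \<open>linear f\<close>] linear_cmul[OF \<open>linear f\<close>] inner_diff_left
          inner_diff_right power2_eq_square algebra_simps)
    finally show ?thesis .
  qed
  \<comment> \<open>The quadratic is least at A / C; the added 1 keeps the denominator positive when
    C = 0, and t C \<le> A still holds.\<close>
  define t where "t = A / (C + 1)"
  have "t > 0" using A C by (simp add: t_def)
  have "t * C \<le> A"
    using A C by (simp add: t_def field_simps)
  have "t\<^sup>2 * C - 2 * t * A = t * (t * C - 2 * A)"
    by (simp add: power2_eq_square algebra_simps)
  also have "\<dots> < 0"
    using \<open>t > 0\<close> \<open>t * C \<le> A\<close> A by (intro mult_pos_neg) auto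
  finally show False using quad[of t] by simp
qed

text \<open>
  No spectral theorem is needed: a minimiser of the Rayleigh quotient on the orthogonal complement
  of the kernel is an eigenvector.
\<close>

lemma spectral_gap:
  fixes f P :: "'a::euclidean_space \<Rightarrow> 'a"
  assumes f: "linear f" and sa: "\<And>x y. x \<bullet> f y = f x \<bullet> y"
    and P: "linear P" and P_sa: "\<And>x y. x \<bullet> P y = P x \<bullet> y"
    and P_idem: "\<And>x. P (P x) = P x" and P_range: "range P = {v. f v = 0}"
    and e: "\<And>\<mu> v. \<lbrakk>\<mu> \<noteq> 0; v \<noteq> 0; f v = \<mu> *\<^sub>R v\<rbrakk> \<Longrightarrow> e \<le> \<mu>"
  shows "e * (v \<bullet> v - v \<bullet> P v) \<le> v \<bullet> f v"
proof -
  have fP: "f (P x) = 0" for x using P_range by blast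
  \<comment> \<open>The range of \<open>f\<close> is orthogonal to its kernel: moving
    \<open>P\<close> and then \<open>f\<close> across the inner product leads to
    \<open>f (P _)\<close>, which is 0.\<close>
  have Pf: "P (f x) = 0" for x
  proof -
    have "P (f x) \<bullet> P (f x) = f x \<bullet> P (P (f x))" by (simp add: P_sa)
    also have "\<dots> = x \<bullet> f (P (f x))" by (simp add: P_idem sa)
    finally show ?thesis by (simp add: fP)
  qed
  \<comment> \<open>Both sides of the claim depend only on the component \<open>x - P x\<close>
    orthogonal to the kernel, so a bound for unit vectors there suffices.\<close>
  have decomp: "x \<bullet> f x = (x - P x) \<bullet> f (x - P x)" for x
    by (simp add: linear_diff[OF f] fP inner_diff_left P_sa[symmetric] Pf)
  have sq: "x \<bullet> x - x \<bullet> P x = (x - P x) \<bullet> (x - P x)" for x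
    using P_sa[of x "P x"]
    by (simp add: inner_diff_left inner_diff_right P_idem inner_commute)
  \<comment> \<open>The unit sphere of the orthogonal complement of the kernel. If it is empty,
    \<open>P\<close> is the identity and both sides of the claim are 0.\<close>
  define S where "S = {w. P w = 0} \<inter> sphere 0 1"
  show ?thesis
  proof (cases "S = {}")
    case True
    have "v - P v = 0"
    proof (rule ccontr)
      assume "v - P v \<noteq> 0"
      then have "(1 / norm (v - P v)) *\<^sub>R (v - P v) \<in> S"
        by (simp add: S_def linear_cmul[OF P] linear_diff[OF P] P_idem)
      with True show False by blast
    qed
    then show ?thesis using decomp[of v] sq[of v] by (simp add: linear_0[OF f])
  next
    case False
    have "continuous_on UNIV P" "continuous_on S f"
      using P f by (simp_all add: linear_continuous_on linear_conv_bounded_linear)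
    then have "closed {w. P w = 0}"
      by (intro closed_Collect_eq) auto
    then have "compact S" unfolding S_def by (intro closed_Int_compact compact_sphere)
    then obtain w where w: "w \<in> S" and min: "\<And>y. y \<in> S \<Longrightarrow> w \<bullet> f w \<le> y \<bullet> f y"
      using continuous_attains_inf[of S "\<lambda>y. y \<bullet> f y"] False
        continuous_on_inner[OF continuous_on_id \<open>continuous_on S f\<close>]
      by (auto simp: id_def)
    define \<mu> where "\<mu> = w \<bullet> f w"
    have Pw: "P w = 0" and nw: "norm w = 1" using w by (auto simp: S_def)
    have rayleigh: "\<mu> * (x \<bullet> x - x \<bullet> P x) \<le> x \<bullet> f x" for x
    proof (cases "x - P x = 0")
      case True
      then show ?thesis using decomp[of x] sq[of x] by (simp add: linear_0[OF f])
    next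
      case False
      let ?u = "x - P x"
      have "(1 / norm ?u) *\<^sub>R ?u \<in> S"
        using False by (simp add: S_def linear_cmul[OF P] linear_diff[OF P] P_idem)
      from min[OF this] have "\<mu> \<le> (?u \<bullet> f ?u) / (?u \<bullet> ?u)"
        by (simp add: \<mu>_def linear_cmul[OF f] dot_square_norm power2_eq_square
            del: scaleR_diff_right)
      moreover have "?u \<bullet> ?u > 0" using False by simp
      ultimately have "\<mu> * (?u \<bullet> ?u) \<le> ?u \<bullet> f ?u" by (simp add: pos_le_divide_eq)
      then show ?thesis unfolding decomp[of x] sq[of x] .
    qed
    \<comment> \<open>By \<open>rayleigh\<close> the form of \<open>k\<close> is nonnegative, and it
      vanishes at the minimiser \<open>w\<close>. Hence \<open>k w = 0\<close>, which is the
      eigenvalue equation because \<open>P w = 0\<close>.\<close>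
    define k where "k x = f x - \<mu> *\<^sub>R (x - P x)" for x
    have "linear k"
      by (rule linearI)
        (simp_all add: k_def linear_add[OF f] linear_add[OF P] linear_cmul[OF f]
          linear_cmul[OF P] algebra_simps)
    moreover have "x \<bullet> k y = k x \<bullet> y" for x y
      by (simp add: k_def inner_diff_left inner_diff_right sa P_sa)
    moreover have "0 \<le> x \<bullet> k x" for x
      using rayleigh[of x] by (simp add: k_def inner_diff_right)
    moreover have "w \<bullet> k w = 0"
      using nw by (simp add: k_def inner_diff_right Pw dot_square_norm flip: \<mu>_def)
    ultimately have "k w = 0" by (rule selfadjoint_nonneg_null)
    then have eig: "f w = \<mu> *\<^sub>R w" by (simp add: k_def Pw)
    have "w \<noteq> 0" using nw by auto
    have "\<mu> \<noteq> 0"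
    proof
      assume "\<mu> = 0"
      then have "w \<in> range P" using eig P_range by simp
      then have "P w = w" using P_idem by auto
      with Pw \<open>w \<noteq> 0\<close> show False by simp
    qed
    have "e \<le> \<mu>" by (rule e[OF \<open>\<mu> \<noteq> 0\<close> \<open>w \<noteq> 0\<close> eig])
    then have "e * (v \<bullet> v - v \<bullet> P v) \<le> \<mu> * (v \<bullet> v - v \<bullet> P v)"
      unfolding sq by (intro mult_right_mono) auto
    with rayleigh[of v] show ?thesis by linarith
  qed
qed

section \<open>Positive semidefinite operators, traces and Hermitian matrices\<close>

definition outer :: "complex ^ 'b \<Rightarrow> complex ^ 'b ^ 'b" where
  "outer v = (\<chi> x y. v $ x * cnj (v $ y))"

text \<open>
  Finite sums of rank-one operators, so that maps and inequalities linear in the state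
  need only be checked on \<open>outer v\<close>.
\<close>

inductive psd :: "complex ^ 'b ^ 'b \<Rightarrow> bool" where
  psd_0: "psd 0"
| psd_add_outer: "psd A \<Longrightarrow> psd (A + outer v)"

lemma psd_outer: "psd (outer v)"
  using psd_add_outer[OF psd_0] by simp

lemma psd_add: "psd A \<Longrightarrow> psd B \<Longrightarrow> psd (B + A)"
  by (induction A rule: psd.induct) (auto simp: add.assoc[symmetric] intro: psd_add_outer)

lemma psd_sum: "(\<And>k. k \<in> K \<Longrightarrow> psd (A k)) \<Longrightarrow> psd (\<Sum>k\<in>K. A k)"
  by (induction K rule: infinite_finite_induct) (auto intro: psd_add psd_0)

text \<open>Applied to scaling, to conjugation by a Hermitian matrix and to the twirl, the building
  blocks of the channel.\<close>

lemma psd_additive_image: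
  assumes "psd A" and "f 0 = 0" and "\<And>A B. f (A + B) = f A + f B" and "\<And>v. psd (f (outer v))"
  shows "psd (f A)"
  using assms(1) by induction (auto simp: assms intro: psd_0 psd_add)

lemma psd_scaleR:
  assumes "psd A" and "r \<ge> 0"
  shows "psd (r *\<^sub>R A)"
proof (rule psd_additive_image[OF \<open>psd A\<close>, of "\<lambda>A. r *\<^sub>R A"])
  fix v :: "complex ^ 'a"
  have "r *\<^sub>R outer v = outer (sqrt r *\<^sub>R v)"
    using \<open>r \<ge> 0\<close> by (simp add: outer_def vec_eq_iff)
  then show "psd (r *\<^sub>R outer v)" by (simp add: psd_outer)
qed (auto simp: algebra_simps)

lemma matrix_add_rdistrib:
  fixes A B :: "'a::semiring_1 ^ 'm ^ 'n"
  shows "(A + B) ** C = A ** C + B ** C"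
  by (vector matrix_matrix_mult_def sum.distrib[symmetric] distrib_right)

lemma psd_conjugate:
  fixes A :: "complex ^ 'b::finite ^ 'b"
  assumes "psd A" and "conj_transpose M = M"
  shows "psd (M ** A ** M)"
proof (rule psd_additive_image[OF \<open>psd A\<close>, of "\<lambda>A. M ** A ** M"])
  fix v :: "complex ^ 'b"
  have M: "cnj (M $ x $ y) = M $ y $ x" for x y
    using \<open>conj_transpose M = M\<close> by (auto simp: conj_transpose_def vec_eq_iff)
  have "(M ** outer v ** M) $ x $ y = outer (M *v v) $ x $ y" for x y
  proof -
    have "(M ** outer v ** M) $ x $ y = (\<Sum>k\<in>UNIV. (M *v v) $ x * (cnj (v $ k) * M $ k $ y))"
      by (simp add: outer_def matrix_matrix_mult_def matrix_vector_mult_def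
          sum_distrib_right mult.assoc)
    also have "\<dots> = (M *v v) $ x * (\<Sum>k\<in>UNIV. cnj (v $ k) * M $ k $ y)"
      by (simp only: sum_distrib_left)
    also have "(\<Sum>k\<in>UNIV. cnj (v $ k) * M $ k $ y) = cnj ((M *v v) $ y)"
      by (simp add: matrix_vector_mult_def M mult.commute)
    also have "(M *v v) $ x * \<dots> = outer (M *v v) $ x $ y"
      by (simp add: outer_def)
    finally show ?thesis .
  qed
  then have "M ** outer v ** M = outer (M *v v)" by (simp add: vec_eq_iff)
  then show "psd (M ** outer v ** M)" by (simp add: psd_outer)
qed (simp_all add: matrix_add_ldistrib matrix_add_rdistrib)

lemma psd_twirl:
  assumes "psd A"
  shows "psd (twirl k A)"
proof (rule psd_additive_image[OF assms])
  fix v :: "complex ^ ('a \<Rightarrow> bool)"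
  \<comment> \<open>Kraus form of the twirl: the vector on the right is |t><s| on qubit k applied to
    \<open>v\<close>, and each of the four pairs (t, s) has weight 1/2.\<close>
  have "twirl k (outer v) =
      (\<Sum>t\<in>UNIV. \<Sum>s\<in>UNIV. (1/2) *\<^sub>R outer (\<chi> x. if x k = t then v $ (x(k := s)) else 0))"
    by (auto simp: twirl_def outer_def vec_eq_iff UNIV_bool scaleR_conv_of_real[where 'a=complex])
  then show "psd (twirl k (outer v))"
    by (auto intro!: psd_sum psd_scaleR psd_outer)
qed (auto simp: twirl_def vec_eq_iff sum.distrib distrib_left)

text \<open>The inner product on complex vectors is the real part of the Hermitian one, hence the
  \<open>Re\<close>. Trace inequalities thereby reduce to inequalities between quadratic
  forms.\<close>

lemma trace_mult_outer:
  fixes v :: "complex ^ 'b::finite"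
  shows "Re (trace (A ** outer v)) = v \<bullet> (A *v v)"
  by (simp add: trace_def matrix_matrix_mult_def matrix_vector_mult_def outer_def inner_vec_def
     inner_complex_def sum_distrib_left sum_distrib_right algebra_simps sum.distrib sum_subtractf)

lemma psd_trace_mono:
  fixes A B :: "complex ^ 'b::finite ^ 'b"
  assumes "psd \<rho>" and "\<And>v. v \<bullet> (A *v v) \<le> v \<bullet> (B *v v)"
  shows "Re (trace (A ** \<rho>)) \<le> Re (trace (B ** \<rho>))"
  using assms(1)
  by induction (auto simp: matrix_add_ldistrib trace_add trace_mult_outer intro: add_mono assms)

lemma psd_hermitian: "psd A \<Longrightarrow> conj_transpose A = A"
  by (induction rule: psd.induct)
    (simp_all add: conj_transpose_def outer_def vec_eq_iff mult.commute)

lemma trace_mult_hermitian_real: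
  fixes A B :: "complex ^ 'b::finite ^ 'b"
  assumes "conj_transpose A = A" and "conj_transpose B = B"
  shows "trace (A ** B) \<in> \<real>"
proof -
  have AB: "cnj (A $ x $ y) = A $ y $ x" "cnj (B $ x $ y) = B $ y $ x" for x y
    using assms by (auto simp: conj_transpose_def vec_eq_iff)
  have "cnj (trace (A ** B)) = trace (B ** A)"
    by (simp add: trace_def matrix_matrix_mult_def AB mult.commute)
  then show ?thesis by (simp add: trace_mul_sym[of B A] Reals_cnj_iff)
qed

text \<open>Bridge to \<open>spectral_gap\<close>, which sees the complex vectors as a real
  Euclidean space.\<close>

lemma hermitian_selfadjoint:
  fixes A :: "complex ^ 'b::finite ^ 'b"
  assumes "conj_transpose A = A"
  shows "v \<bullet> (A *v w) = (A *v v) \<bullet> w"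
proof -
  have A: "cnj (A $ x $ y) = A $ y $ x" for x y
    using assms by (auto simp: conj_transpose_def vec_eq_iff)
  have move: "inner p (c * q) = inner (cnj c * p) q" for p c q :: complex
    by (simp add: inner_complex_def algebra_simps)
  have "v \<bullet> (A *v w) = (\<Sum>x\<in>UNIV. \<Sum>y\<in>UNIV. inner (v $ x) (A $ x $ y * w $ y))"
    by (simp add: inner_vec_def matrix_vector_mult_def inner_sum_right)
  also have "\<dots> = (\<Sum>y\<in>UNIV. \<Sum>x\<in>UNIV. inner (A $ y $ x * v $ x) (w $ y))"
    by (subst sum.swap) (simp add: move A)
  also have "\<dots> = (A *v v) \<bullet> w"
    by (simp add: inner_vec_def matrix_vector_mult_def inner_sum_left)
  finally show ?thesis .
qed

lemma hermitian_idempotent_inner: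
  fixes A :: "complex ^ 'b::finite ^ 'b"
  assumes "conj_transpose A = A" and "A ** A = A"
  shows "v \<bullet> (A *v v) = (A *v v) \<bullet> (A *v v)"
  using hermitian_selfadjoint[OF assms(1), of v "A *v v"] assms(2)
  by (simp add: matrix_vector_mul_assoc)

lemma linear_trace_mult:
  fixes A :: "complex ^ 'b::finite ^ 'b"
  shows "linear (\<lambda>X. trace (A ** X))"
  by (rule linearI)
    (simp_all add: trace_def matrix_matrix_mult_def scaleR_sum_right distrib_left sum.distrib)

lemma matrix_diff_distrib:
  fixes A B :: "'a::ring_1 ^ 'm ^ 'm"
  shows "C ** (A - B) = C ** A - C ** B" and "(A - B) ** C = A ** C - B ** C"
  by (simp_all add: matrix_matrix_mult_def vec_eq_iff sum_subtractf left_diff_distrib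
      right_diff_distrib)

section \<open>Clauses are orthogonal projectors\<close>

lemma conj_transpose_clause: "conj_transpose (clause i j a b) = clause i j a b"
  by (auto simp: conj_transpose_def clause_def vec_eq_iff mult.commute)

lemma clause_nonzeroD:
  assumes "clause i j a b $ x $ y \<noteq> 0"
  shows "x i \<noteq> x j" and "y i \<noteq> y j" and "\<And>k. k \<noteq> i \<Longrightarrow> k \<noteq> j \<Longrightarrow> x k = y k"
  using assms by (auto simp: clause_def clause_amp_def split: if_splits)

lemma clause_idempotent:
  assumes "i \<noteq> j" and "(cmod a)\<^sup>2 + (cmod b)\<^sup>2 = 1"
  shows "clause i j a b ** clause i j a b = clause i j a b"
proof -
  let ?C = "clause i j a b"
  have norm1: "a * cnj a + b * cnj b = 1"
    using assms(2) by (metis complex_norm_square of_real_1 of_real_add)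
  have "(\<Sum>y\<in>UNIV. ?C $ x $ y * ?C $ y $ z) = ?C $ x $ z" for x z
  proof -
    \<comment> \<open>The only intermediate strings that can contribute: they agree with
      \<open>x\<close> off \<open>i\<close> and \<open>j\<close> and carry 01 or 10 there. Their
      weights sum to the squared norm of the clause vector.\<close>
    let ?p = "x(i := False, j := True)" and ?q = "x(i := True, j := False)"
    have "?p \<noteq> ?q" using \<open>i \<noteq> j\<close> by (auto dest: fun_cong[where x = i])
    have "(\<Sum>y\<in>UNIV. ?C $ x $ y * ?C $ y $ z) = (\<Sum>y\<in>{?p, ?q}. ?C $ x $ y * ?C $ y $ z)"
    proof (rule sum.mono_neutral_right)
      show "\<forall>y\<in>UNIV - {?p, ?q}. ?C $ x $ y * ?C $ y $ z = 0"
      proof (rule ballI, rule ccontr)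
        fix y assume y: "y \<in> UNIV - {?p, ?q}" and "?C $ x $ y * ?C $ y $ z \<noteq> 0"
        then have nz: "?C $ x $ y \<noteq> 0" by simp
        have "y = ?p \<or> y = ?q"
        proof (cases "y i")
          case True
          then have "y = ?q" using clause_nonzeroD[OF nz] by (auto simp: fun_eq_iff)
          then show ?thesis ..
        next
          case False
          then have "y = ?p" using clause_nonzeroD[OF nz] by (auto simp: fun_eq_iff)
          then show ?thesis ..
        qed
        with y show False by simp
      qed
    qed auto
    also have "\<dots> = ?C $ x $ ?p * ?C $ ?p $ z + ?C $ x $ ?q * ?C $ ?q $ z"
      using \<open>?p \<noteq> ?q\<close> by simp
    also have "\<dots> = ?C $ x $ z * (a * cnj a + b * cnj b)"
    proof -
      define agree where "agree u w \<longleftrightarrow> (\<forall>k. k \<noteq> i \<and> k \<noteq> j \<longrightarrow> u k = w k)" for u w :: "'a \<Rightarrow> bool"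
      have "agree x ?p" "agree x ?q" "agree ?p z = agree x z" "agree ?q z = agree x z"
        by (auto simp: agree_def)
      then show ?thesis
        using \<open>i \<noteq> j\<close>
        by (simp add: clause_def clause_amp_def[of _ _ True] clause_amp_def[of _ _ False]
            algebra_simps flip: agree_def)
    qed
    finally show ?thesis by (simp add: norm1)
  qed
  then show ?thesis by (simp add: matrix_matrix_mult_def vec_eq_iff)
qed

section \<open>Diagonal observables under twirl and clause channel\<close>

definition diagonal :: "('b \<Rightarrow> real) \<Rightarrow> complex ^ 'b ^ 'b" where
  "diagonal f = (\<chi> x y. if x = y then complex_of_real (f x) else 0)"

lemma diagonal_mult: "(diagonal f ** A) $ x $ y = of_real (f x) * A $ x $ y"
  by (simp add: diagonal_def matrix_matrix_mult_def if_distrib[of "\<lambda>c. c * _"] cong: if_cong)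

lemma mult_diagonal: "(A ** diagonal f) $ x $ y = of_real (f y) * A $ x $ y"
  by (simp add: diagonal_def matrix_matrix_mult_def if_distrib[of "\<lambda>c. _ * c"] mult.commute
      cong: if_cong)

lemma trace_diagonal_mult: "trace (diagonal f ** A) = (\<Sum>x\<in>UNIV. of_real (f x) * A $ x $ x)"
  by (simp add: trace_def diagonal_mult)

lemma diagonal_mult_vec: "(diagonal f *v v) $ x = of_real (f x) * v $ x"
  by (simp add: diagonal_def matrix_vector_mult_def if_distrib[of "\<lambda>c. c * _"] cong: if_cong)

text \<open>Summing over both values of bit k is the same as adding the value at the flipped string,
  and flipping is an involution, so it can be moved from one factor to the other.\<close>

lemma sum_update_swap:
  fixes g h :: "('n::finite \<Rightarrow> bool) \<Rightarrow> 'a::comm_semiring_1"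
  shows "(\<Sum>x\<in>UNIV. g x * (h (x(k := True)) + h (x(k := False)))) =
         (\<Sum>x\<in>UNIV. (g (x(k := True)) + g (x(k := False))) * h x)"
proof -
  define flip where "flip x = x(k := \<not> x k)" for x :: "'n \<Rightarrow> bool"
  have split: "r (x(k := True)) + r (x(k := False)) = r x + r (flip x)"
    for r :: "('n \<Rightarrow> bool) \<Rightarrow> 'a" and x
    by (cases "x k") (simp_all add: flip_def add.commute fun_upd_idem)
  have "(\<Sum>x\<in>UNIV. g x * h (flip x)) = (\<Sum>x\<in>UNIV. g (flip x) * h x)"
    by (rule sum.reindex_bij_witness[of _ flip flip]) (auto simp: flip_def)
  then show ?thesis by (simp add: split distrib_left distrib_right sum.distrib)
qed

text \<open>Heisenberg picture: the twirl is moved from the state to the observable, where it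
  averages \<open>f\<close> over bit k.\<close>

lemma trace_diagonal_twirl:
  "trace (diagonal f ** twirl k \<sigma>) =
    (\<Sum>x\<in>UNIV. of_real ((f (x(k := True)) + f (x(k := False))) / 2) * \<sigma> $ x $ x)"
proof -
  have "trace (diagonal f ** twirl k \<sigma>) = (\<Sum>x\<in>UNIV. of_real (f x) / 2 *
     (\<sigma> $ (x(k := True)) $ (x(k := True)) + \<sigma> $ (x(k := False)) $ (x(k := False))))"
    by (simp add: trace_diagonal_mult twirl_def UNIV_bool add.commute)
  also have "\<dots> = (\<Sum>x\<in>UNIV. (of_real (f (x(k := True))) / 2 + of_real (f (x(k := False))) / 2)
     * \<sigma> $ x $ x)"
    by (rule sum_update_swap[of _ "\<lambda>x. \<sigma> $ x $ x"])
  finally show ?thesis by (simp add: add_divide_distrib)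
qed

text \<open>By \<open>inv\<close> the observable commutes with the clause, so the unviolated branch
  loses exactly the weight of the violated one. Randomising returns that weight plus
  \<open>c\<close> times the probability of violation.\<close>

lemma trace_diagonal_clause_channel:
  fixes \<rho> :: "('n::finite) operator"
  assumes "i \<noteq> j" and "(cmod a)\<^sup>2 + (cmod b)\<^sup>2 = 1"
    and inv: "\<And>x y. clause i j a b $ x $ y \<noteq> 0 \<Longrightarrow> f x = f y"
    and avg: "\<And>x. x i \<noteq> x j \<Longrightarrow>
      (f (x(i := True)) + f (x(i := False)) + f (x(j := True)) + f (x(j := False))) / 4 = f x + c"
  shows "trace (diagonal f ** clause_channel i j (clause i j a b) \<rho>) =
    trace (diagonal f ** \<rho>) + of_real c * trace (clause i j a b ** \<rho>)"
proof -
  define C where "C = clause i j a b"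
  define F where "F = (diagonal f :: 'n operator)"
  define \<sigma> where "\<sigma> = C ** \<rho> ** C"
  have CC: "C ** C = C" unfolding C_def by (rule clause_idempotent) fact+
  have FC: "F ** C = C ** F"
    using inv by (auto simp: vec_eq_iff F_def C_def diagonal_mult mult_diagonal)
  have F\<sigma>: "trace (F ** \<sigma>) = trace (F ** C ** \<rho>)"
  proof -
    have "trace (F ** \<sigma>) = trace (C ** (F ** C ** \<rho>))"
      unfolding \<sigma>_def by (subst trace_mul_sym) (simp add: matrix_mul_assoc)
    also have "C ** (F ** C ** \<rho>) = F ** (C ** C) ** \<rho>"
      by (simp add: matrix_mul_assoc flip: FC)
    finally show ?thesis by (simp add: CC)
  qed
  have F\<rho>C: "trace (F ** (\<rho> ** C)) = trace (F ** C ** \<rho>)"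
  proof -
    have "trace (F ** (\<rho> ** C)) = trace (C ** (F ** \<rho>))"
      by (subst trace_mul_sym) (simp add: matrix_mul_assoc)
    then show ?thesis by (simp add: matrix_mul_assoc FC)
  qed
  have "(mat 1 - C) ** \<rho> ** (mat 1 - C) = \<rho> - C ** \<rho> - \<rho> ** C + \<sigma>"
    by (simp add: matrix_diff_distrib \<sigma>_def)
  then have kept: "trace (F ** ((mat 1 - C) ** \<rho> ** (mat 1 - C))) = trace (F ** \<rho>) - trace (F ** C ** \<rho>)"
    by (simp add: matrix_diff_distrib matrix_add_ldistrib trace_add trace_sub F\<sigma> F\<rho>C)
      (simp add: matrix_mul_assoc)
  \<comment> \<open>\<open>avg\<close> speaks only of strings with differing bits at
    \<open>i\<close> and \<open>j\<close>; the violated branch has no diagonal weight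
    elsewhere.\<close>
  have \<sigma>0: "\<sigma> $ x $ x = 0" if "x i = x j" for x
  proof -
    have "C $ k $ x = 0" for k
      using clause_nonzeroD(2)[of i j a b k x] that by (auto simp: C_def)
    then show ?thesis unfolding \<sigma>_def by (simp add: matrix_matrix_mult_def[of "C ** \<rho>"])
  qed
  have "trace (F ** ((1/2) *\<^sub>R twirl i \<sigma> + (1/2) *\<^sub>R twirl j \<sigma>)) =
      (1/2) *\<^sub>R trace (F ** twirl i \<sigma>) + (1/2) *\<^sub>R trace (F ** twirl j \<sigma>)"
    by (simp only: linear_add[OF linear_trace_mult] linear_cmul[OF linear_trace_mult])
  also have "\<dots> = (\<Sum>x\<in>UNIV. of_real ((f (x(i := True)) + f (x(i := False)) + f (x(j := True))
      + f (x(j := False))) / 4) * \<sigma> $ x $ x)"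
    unfolding F_def trace_diagonal_twirl
    by (simp add: scaleR_sum_right scaleR_conv_of_real[where 'a = complex]
        add_divide_distrib distrib_right sum_divide_distrib add.assoc flip: sum.distrib)
  also have "\<dots> = (\<Sum>x\<in>UNIV. of_real (f x + c) * \<sigma> $ x $ x)"
    by (rule sum.cong[OF refl]) (metis avg \<sigma>0 mult_zero_right)
  also have "\<dots> = trace (F ** \<sigma>) + of_real c * trace \<sigma>"
    by (simp add: F_def trace_diagonal_mult distrib_right sum.distrib sum_distrib_left
        trace_def[of \<sigma>])
  also have "trace \<sigma> = trace (C ** \<rho>)"
    unfolding \<sigma>_def by (subst trace_mul_sym) (simp add: matrix_mul_assoc CC)
  finally have "trace (F ** ((1/2) *\<^sub>R twirl i \<sigma> + (1/2) *\<^sub>R twirl j \<sigma>)) =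
      trace (F ** C ** \<rho>) + of_real c * trace (C ** \<rho>)" by (simp add: F\<sigma>)
  moreover have "trace (F ** clause_channel i j C \<rho>) =
      trace (F ** ((mat 1 - C) ** \<rho> ** (mat 1 - C))) +
      trace (F ** ((1/2) *\<^sub>R twirl i \<sigma> + (1/2) *\<^sub>R twirl j \<sigma>))"
    unfolding clause_channel_def \<sigma>_def[symmetric]
    by (simp only: linear_add[OF linear_trace_mult] add.assoc)
  ultimately show ?thesis
    unfolding F_def[symmetric] C_def[symmetric] by (simp add: kept)
qed

section \<open>Magnetization and its square\<close>

definition magnetization :: "('n::finite \<Rightarrow> bool) \<Rightarrow> real" where
  "magnetization x = (\<Sum>k\<in>UNIV. if x k then 1/2 else - 1/2)"

lemma magnetization_upd:
  "magnetization (x(k := s)) =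
    magnetization x + (if s then 1/2 else - 1/2) - (if x k then 1/2 else - 1/2)"
  unfolding magnetization_def by (simp add: sum.remove[of UNIV k])

text \<open>A nonzero entry links strings that carry 01 or 10 on the two qubits, and either pair
  contributes 0 to the magnetization.\<close>

lemma magnetization_clause:
  assumes "i \<noteq> j" and "clause i j a b $ x $ y \<noteq> 0"
  shows "magnetization x = magnetization y"
proof -
  note D = clause_nonzeroD[OF assms(2)]
  have "y = x(i := y i, j := y j)" using D(3) by (auto simp: fun_eq_iff)
  then have "magnetization y = magnetization (x(i := y i, j := y j))" by simp
  also have "\<dots> = magnetization x"
    using D(1,2) \<open>i \<noteq> j\<close> by (auto simp: magnetization_upd)
  finally show ?thesis by simp
qed

text \<open>Of the four settings two leave \<open>x\<close> unchanged, one gives 11 and one gives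
  00. With m the magnetization of \<open>x\<close>, the mean of m^2, m^2, (m+1)^2 and (m-1)^2 is m^2
  + 1/2.\<close>

lemma magnetization_avg:
  assumes "i \<noteq> j" and "x i \<noteq> x j"
  shows "((magnetization (x(i := True)))\<^sup>2 + (magnetization (x(i := False)))\<^sup>2
    + (magnetization (x(j := True)))\<^sup>2 + (magnetization (x(j := False)))\<^sup>2) / 4
    = (magnetization x)\<^sup>2 + 1/2"
  using assms by (cases "x i") (auto simp: magnetization_upd power2_eq_square algebra_simps)

lemma magnetization_sq_le:
  fixes x :: "'n::finite \<Rightarrow> bool"
  shows "(magnetization x)\<^sup>2 \<le> (real CARD('n))\<^sup>2 / 4"
proof -
  have "\<bar>magnetization x\<bar> \<le> (\<Sum>k\<in>(UNIV :: 'n set). 1/2)"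
    unfolding magnetization_def by (rule order_trans[OF sum_abs], rule sum_mono) simp
  then have "\<bar>magnetization x\<bar> \<le> \<bar>real CARD('n) / 2\<bar>" by simp
  then have "(magnetization x)\<^sup>2 \<le> (real CARD('n) / 2)\<^sup>2" by (simp only: abs_le_square_iff)
  then show ?thesis by (simp add: power_divide)
qed

section \<open>The averaged channel: positivity, trace and second moment of the
  magnetization\<close>

lemma trace_average_channel:
  "trace (A ** average_channel L i j a b \<rho>) = (1 / real L) *\<^sub>R
    (\<Sum>\<alpha>=1..L. trace (A ** clause_channel (i \<alpha>) (j \<alpha>) (clause (i \<alpha>) (j \<alpha>) (a \<alpha>) (b \<alpha>)) \<rho>))"
  unfolding average_channel_def
  by (simp only: linear_cmul[OF linear_trace_mult] linear_sum[OF linear_trace_mult])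

lemma trace_hamiltonian_mult:
  "trace (hamiltonian L i j a b ** \<rho>) =
    (\<Sum>\<alpha>=1..L. trace (clause (i \<alpha>) (j \<alpha>) (a \<alpha>) (b \<alpha>) ** \<rho>))"
  unfolding hamiltonian_def
  \<comment> \<open>Cyclicity puts the sum into the second factor, where
    \<open>linear_trace_mult\<close> applies.\<close>
  by (subst (1 2) trace_mul_sym) (simp only: linear_sum[OF linear_trace_mult])

lemma psd_average_channel:
  assumes "psd \<rho>"
  shows "psd (average_channel L i j a b \<rho>)"
proof -
  have "conj_transpose (mat 1 - clause k l c d) = mat 1 - clause k l c d" for k l :: 'a and c d
    using conj_transpose_clause[of k l c d]
    by (auto simp: conj_transpose_def vec_eq_iff mat_def)
  then show ?thesis
    unfolding average_channel_def clause_channel_def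
    by (auto intro!: psd_scaleR psd_sum psd_add psd_twirl psd_conjugate conj_transpose_clause assms)
qed

lemma psd_maximally_mixed: "psd maximally_mixed"
proof -
  have "(mat 1 :: 'a operator) = (\<Sum>x\<in>UNIV. outer (axis x 1))"
    by (simp add: vec_eq_iff mat_def outer_def axis_def if_distrib[of cnj]
        if_distrib[of "\<lambda>c. _ * c"] if_distrib[of "\<lambda>c. c * _"] cong: if_cong)
  then show ?thesis
    unfolding maximally_mixed_def by (auto intro!: psd_scaleR psd_sum psd_outer)
qed

lemma trace_average_channel_preserving:
  assumes "L \<ge> 1"
    and "\<And>\<alpha>. \<alpha> \<in> {1..L} \<Longrightarrow> i \<alpha> \<noteq> j \<alpha>"
    and "\<And>\<alpha>. \<alpha> \<in> {1..L} \<Longrightarrow> (cmod (a \<alpha>))\<^sup>2 + (cmod (b \<alpha>))\<^sup>2 = 1"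
  shows "trace (average_channel L i j a b \<rho>) = trace \<rho>"
proof -
  have 1: "diagonal (\<lambda>x. 1) = mat 1" by (simp add: diagonal_def mat_def vec_eq_iff)
  have "trace (clause_channel (i \<alpha>) (j \<alpha>) (clause (i \<alpha>) (j \<alpha>) (a \<alpha>) (b \<alpha>)) \<rho>) = trace \<rho>"
    if "\<alpha> \<in> {1..L}" for \<alpha>
    \<comment> \<open>The identity is the constant diagonal observable 1, whose gain is 0.\<close>
    using trace_diagonal_clause_channel[OF assms(2,3)[OF that], of "\<lambda>x. 1" 0 \<rho>]
    by (simp add: 1)
  then show ?thesis
    using \<open>L \<ge> 1\<close> trace_average_channel[of "mat 1" L i j a b \<rho>]
    by (simp add: scaleR_conv_of_real)
qed

text \<open>Clause \<alpha> gains 1/2 times its violation probability; the mean over the L clauses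
  turns the sum of these probabilities into the energy divided by 2 L.\<close>

lemma trace_magnetization_average_channel:
  assumes "L \<ge> 1"
    and "\<And>\<alpha>. \<alpha> \<in> {1..L} \<Longrightarrow> i \<alpha> \<noteq> j \<alpha>"
    and "\<And>\<alpha>. \<alpha> \<in> {1..L} \<Longrightarrow> (cmod (a \<alpha>))\<^sup>2 + (cmod (b \<alpha>))\<^sup>2 = 1"
  defines "F \<equiv> diagonal (\<lambda>x. (magnetization x)\<^sup>2)"
  shows "Re (trace (F ** average_channel L i j a b \<rho>)) =
    Re (trace (F ** \<rho>)) + Re (trace (hamiltonian L i j a b ** \<rho>)) / (2 * real L)"
proof -
  let ?C = "\<lambda>\<alpha>. clause (i \<alpha>) (j \<alpha>) (a \<alpha>) (b \<alpha>)"
  have "trace (F ** clause_channel (i \<alpha>) (j \<alpha>) (?C \<alpha>) \<rho>) =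
      trace (F ** \<rho>) + of_real (1/2) * trace (?C \<alpha> ** \<rho>)" if "\<alpha> \<in> {1..L}" for \<alpha>
    unfolding F_def
    by (rule trace_diagonal_clause_channel[OF assms(2,3)[OF that]])
      (use magnetization_clause[OF assms(2)[OF that]] magnetization_avg[OF assms(2)[OF that]]
       in auto)
  then have "(\<Sum>\<alpha>=1..L. trace (F ** clause_channel (i \<alpha>) (j \<alpha>) (?C \<alpha>) \<rho>)) =
      of_nat L * trace (F ** \<rho>) + trace (hamiltonian L i j a b ** \<rho>) / 2"
    by (simp add: sum.distrib trace_hamiltonian_mult sum_divide_distrib)
  from arg_cong[OF this, of Re] show ?thesis
    using \<open>L \<ge> 1\<close> by (simp add: trace_average_channel field_simps)
qed

section \<open>Energy, ground space projector and gap\<close>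

text \<open>Each clause is an orthogonal projector, so its form is a squared norm. Hence the energy
  is nonnegative and vanishes only if every clause annihilates \<open>v\<close>.\<close>

lemma inner_hamiltonian:
  assumes "\<And>\<alpha>. \<alpha> \<in> {1..L} \<Longrightarrow> i \<alpha> \<noteq> j \<alpha>"
    and "\<And>\<alpha>. \<alpha> \<in> {1..L} \<Longrightarrow> (cmod (a \<alpha>))\<^sup>2 + (cmod (b \<alpha>))\<^sup>2 = 1"
  shows "v \<bullet> (hamiltonian L i j a b *v v) =
    (\<Sum>\<alpha>=1..L. (norm (clause (i \<alpha>) (j \<alpha>) (a \<alpha>) (b \<alpha>) *v v))\<^sup>2)"
proof -
  let ?C = "\<lambda>\<alpha>. clause (i \<alpha>) (j \<alpha>) (a \<alpha>) (b \<alpha>)"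
  have "(\<Sum>\<alpha>\<in>A. ?C \<alpha>) *v v = (\<Sum>\<alpha>\<in>A. ?C \<alpha> *v v)" for A
    by (induction A rule: infinite_finite_induct) (simp_all add: matrix_vector_mult_add_rdistrib)
  then have "v \<bullet> (hamiltonian L i j a b *v v) = (\<Sum>\<alpha>=1..L. v \<bullet> (?C \<alpha> *v v))"
    by (simp add: hamiltonian_def inner_sum_right)
  also have "\<dots> = (\<Sum>\<alpha>=1..L. (norm (?C \<alpha> *v v))\<^sup>2)"
    by (intro sum.cong refl)
      (simp only: hermitian_idempotent_inner[OF conj_transpose_clause clause_idempotent[OF assms]]
        power2_norm_eq_inner)
  finally show ?thesis .
qed

lemma conj_transpose_hamiltonian:
  "conj_transpose (hamiltonian L i j a b) = hamiltonian L i j a b"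
proof -
  have "cnj (clause k l c d $ y $ x) = clause k l c d $ x $ y" for k l :: 'a and c d x y
    using conj_transpose_clause[of k l c d] by (auto simp: conj_transpose_def vec_eq_iff)
  then show ?thesis by (simp add: hamiltonian_def conj_transpose_def vec_eq_iff)
qed

text \<open>On a ground vector the squared norms in \<open>inner_hamiltonian\<close> sum to 0, so
  each is 0. The second identity is the adjoint of the first.\<close>

lemma projector_absorbs_clause:
  assumes "\<And>\<alpha>. \<alpha> \<in> {1..L} \<Longrightarrow> i \<alpha> \<noteq> j \<alpha>"
    and "\<And>\<alpha>. \<alpha> \<in> {1..L} \<Longrightarrow> (cmod (a \<alpha>))\<^sup>2 + (cmod (b \<alpha>))\<^sup>2 = 1"
    and P: "orthogonal_projector_onto P (mat_kernel (hamiltonian L i j a b))"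
    and \<alpha>: "\<alpha> \<in> {1..L}"
  shows "clause (i \<alpha>) (j \<alpha>) (a \<alpha>) (b \<alpha>) ** P = 0"
    and "P ** clause (i \<alpha>) (j \<alpha>) (a \<alpha>) (b \<alpha>) = 0"
proof -
  let ?C = "\<lambda>\<alpha>. clause (i \<alpha>) (j \<alpha>) (a \<alpha>) (b \<alpha>)"
  have P_herm: "conj_transpose P = P" and P_idem: "P ** P = P"
    and ker: "hamiltonian L i j a b *v (P *v v) = 0" for v
    using P by (auto simp: orthogonal_projector_onto_def mat_kernel_def)
  have CP: "?C \<alpha> *v (P *v v) = 0" for v
  proof -
    have "(\<Sum>\<alpha>=1..L. (norm (?C \<alpha> *v (P *v v)))\<^sup>2) = 0"
      using inner_hamiltonian[where i = i and j = j and a = a and b = b and L = L and v = "P *v v", OF assms(1,2)] by (simp add: ker)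
    then show ?thesis using \<alpha> by (simp add: sum_nonneg_eq_0_iff)
  qed
  then show "?C \<alpha> ** P = 0"
    by (metis matrix_eq matrix_vector_mul_assoc matrix_vector_mult_0)
  have "P *v (?C \<alpha> *v v) = 0" for v
  proof -
    have "(P *v (?C \<alpha> *v v)) \<bullet> (P *v (?C \<alpha> *v v)) = (?C \<alpha> *v v) \<bullet> (P *v (?C \<alpha> *v v))"
      by (simp add: hermitian_idempotent_inner[OF P_herm P_idem])
    also have "\<dots> = v \<bullet> (?C \<alpha> *v (P *v (?C \<alpha> *v v)))"
      by (rule hermitian_selfadjoint[OF conj_transpose_clause, symmetric])
    finally show ?thesis by (simp add: CP)
  qed
  then show "P ** ?C \<alpha> = 0"
    by (metis matrix_eq matrix_vector_mul_assoc matrix_vector_mult_0)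
qed

text \<open>The unviolated branch preserves the ground space weight, since \<open>P\<close> absorbs
  \<open>mat 1 - C\<close> on either side for each clause \<open>C\<close>. The twirled branches are
  positive semidefinite and can only add weight.\<close>

lemma trace_projector_average_channel_mono:
  assumes "L \<ge> 1"
    and "\<And>\<alpha>. \<alpha> \<in> {1..L} \<Longrightarrow> i \<alpha> \<noteq> j \<alpha>"
    and "\<And>\<alpha>. \<alpha> \<in> {1..L} \<Longrightarrow> (cmod (a \<alpha>))\<^sup>2 + (cmod (b \<alpha>))\<^sup>2 = 1"
    and P: "orthogonal_projector_onto P (mat_kernel (hamiltonian L i j a b))"
    and "psd \<rho>"
  shows "Re (trace (P ** \<rho>)) \<le> Re (trace (P ** average_channel L i j a b \<rho>))"
proof -
  let ?C = "\<lambda>\<alpha>. clause (i \<alpha>) (j \<alpha>) (a \<alpha>) (b \<alpha>)"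
  have P_herm: "conj_transpose P = P" and P_idem: "P ** P = P"
    using P by (auto simp: orthogonal_projector_onto_def)
  have nonneg: "0 \<le> Re (trace (P ** \<sigma>))" if "psd \<sigma>" for \<sigma>
    using psd_trace_mono[OF that, of 0 P]
    by (simp add: hermitian_idempotent_inner[OF P_herm P_idem] trace_def)
  have step: "Re (trace (P ** \<rho>)) \<le> Re (trace (P ** clause_channel (i \<alpha>) (j \<alpha>) (?C \<alpha>) \<rho>))"
    if \<alpha>: "\<alpha> \<in> {1..L}" for \<alpha>
  proof -
    let ?K = "mat 1 - ?C \<alpha>"
    have "P ** ?C \<alpha> = 0" "?C \<alpha> ** P = 0"
      using projector_absorbs_clause[OF _ _ P \<alpha>] assms(2,3) by blast+
    then have PK: "P ** ?K = P" and KP: "?K ** P = P"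
      by (simp_all add: matrix_diff_distrib)
    have "trace (P ** (?K ** \<rho> ** ?K)) = trace ((P ** ?K) ** \<rho> ** ?K)"
      by (simp add: matrix_mul_assoc)
    also have "\<dots> = trace (?K ** P ** \<rho>)"
      unfolding PK by (subst trace_mul_sym) (simp add: matrix_mul_assoc)
    also have "\<dots> = trace (P ** \<rho>)"
      by (simp add: KP)
    finally have kept: "trace (P ** (?K ** \<rho> ** ?K)) = trace (P ** \<rho>)" .
    have "psd (twirl k (?C \<alpha> ** \<rho> ** ?C \<alpha>))" for k
      by (intro psd_twirl psd_conjugate conj_transpose_clause \<open>psd \<rho>\<close>)
    then have "0 \<le> Re (trace (P ** twirl k (?C \<alpha> ** \<rho> ** ?C \<alpha>)))" for k
      by (rule nonneg)
    then show ?thesis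
      unfolding clause_channel_def
      by (simp only: linear_add[OF linear_trace_mult] linear_cmul[OF linear_trace_mult] kept) simp
  qed
  have "real L * Re (trace (P ** \<rho>)) = (\<Sum>\<alpha>=1..L. Re (trace (P ** \<rho>)))" by simp
  also have "\<dots> \<le> (\<Sum>\<alpha>=1..L. Re (trace (P ** clause_channel (i \<alpha>) (j \<alpha>) (?C \<alpha>) \<rho>)))"
    by (rule sum_mono) (rule step)
  finally show ?thesis
    using \<open>L \<ge> 1\<close> by (simp add: trace_average_channel field_simps)
qed

text \<open>The operator inequality H \<ge> e (1 - P), tested on rank-one operators by
  \<open>spectral_gap\<close>. \<open>trace \<rho>\<close> stays explicit because the induction runs
  through unnormalised operators.\<close>

lemma hamiltonian_gap_trace:
  assumes "smallest_nonzero_eigenvalue (hamiltonian L i j a b) e"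
    and P: "orthogonal_projector_onto P (mat_kernel (hamiltonian L i j a b))"
    and "psd \<rho>"
  shows "e * (Re (trace \<rho>) - Re (trace (P ** \<rho>))) \<le> Re (trace (hamiltonian L i j a b ** \<rho>))"
proof -
  let ?H = "hamiltonian L i j a b"
  have P_herm: "conj_transpose P = P" and P_idem: "P ** P = P"
    and P_range: "range (\<lambda>v. P *v v) = {v. ?H *v v = 0}"
    using P by (auto simp: orthogonal_projector_onto_def mat_kernel_def)
  have gap: "e * (v \<bullet> v - v \<bullet> (P *v v)) \<le> v \<bullet> (?H *v v)" for v
  proof (rule spectral_gap[where f = "(*v) ?H" and P = "(*v) P"])
    fix \<mu> :: real and w
    assume "\<mu> \<noteq> 0" "w \<noteq> 0" "?H *v w = \<mu> *\<^sub>R w"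
    moreover have "\<mu> *\<^sub>R w = complex_of_real \<mu> *s w"
      by (simp add: vec_eq_iff scaleR_conv_of_real[where 'a = complex])
    ultimately have "mat_eigenvalue ?H (of_real \<mu>)"
      unfolding mat_eigenvalue_def by auto
    then show "e \<le> \<mu>"
      using assms(1) \<open>\<mu> \<noteq> 0\<close> by (simp add: smallest_nonzero_eigenvalue_def)
  qed (use P_range in \<open>simp_all add: hermitian_selfadjoint[OF conj_transpose_hamiltonian]
      hermitian_selfadjoint[OF P_herm] matrix_vector_mul_assoc P_idem\<close>)
  have outer1: "Re (trace (outer v)) = v \<bullet> v" for v :: "complex ^ ('a \<Rightarrow> bool)"
    using trace_mult_outer[of "mat 1" v] by simp
  show ?thesis
    using \<open>psd \<rho>\<close>
  proof induction
    case psd_0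
    then show ?case by (simp add: trace_def)
  next
    case (psd_add_outer A v)
    then show ?case
      using gap[of v]
      by (simp add: matrix_add_ldistrib trace_add trace_mult_outer outer1 algebra_simps)
  qed
qed

text \<open>The definition excludes only 0; the sign comes from the nonnegative energy of an
  eigenvector.\<close>

lemma smallest_nonzero_eigenvalue_hamiltonian_pos:
  assumes "\<And>\<alpha>. \<alpha> \<in> {1..L} \<Longrightarrow> i \<alpha> \<noteq> j \<alpha>"
    and "\<And>\<alpha>. \<alpha> \<in> {1..L} \<Longrightarrow> (cmod (a \<alpha>))\<^sup>2 + (cmod (b \<alpha>))\<^sup>2 = 1"
    and e: "smallest_nonzero_eigenvalue (hamiltonian L i j a b) e"
  shows "e > 0"
proof -
  obtain v where "v \<noteq> 0" and v: "hamiltonian L i j a b *v v = complex_of_real e *s v"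
    using e by (auto simp: smallest_nonzero_eigenvalue_def mat_eigenvalue_def)
  have "complex_of_real e *s v = e *\<^sub>R v"
    by (simp add: vec_eq_iff scaleR_conv_of_real[where 'a = complex])
  then have "e * (v \<bullet> v) = (\<Sum>\<alpha>=1..L. (norm (clause (i \<alpha>) (j \<alpha>) (a \<alpha>) (b \<alpha>) *v v))\<^sup>2)"
    using inner_hamiltonian[where i = i and j = j and a = a and b = b and L = L and v = v, OF assms(1,2)] by (simp add: v)
  also have "\<dots> \<ge> 0" by (simp add: sum_nonneg)
  finally have "e \<ge> 0" using \<open>v \<noteq> 0\<close> by (metis inner_gt_zero_iff zero_le_mult_iff not_less)
  moreover have "e \<noteq> 0" using e by (simp add: smallest_nonzero_eigenvalue_def)
  ultimately show ?thesis by simp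
qed

section \<open>Bounds on the second moment and the final contradiction\<close>

lemma trace_magnetization_sq_le:
  fixes \<rho> :: "('n::finite) operator"
  assumes "psd \<rho>"
  shows "Re (trace (diagonal (\<lambda>x. (magnetization x)\<^sup>2) ** \<rho>))
    \<le> (real CARD('n))\<^sup>2 / 4 * Re (trace \<rho>)"
proof -
  define N where "N = (real CARD('n))\<^sup>2 / 4"
  have inner_diagonal: "v \<bullet> (diagonal f *v v) = (\<Sum>x\<in>UNIV. f x * (norm (v $ x))\<^sup>2)"
    for f and v :: "complex ^ ('n \<Rightarrow> bool)"
    by (simp add: inner_vec_def diagonal_mult_vec power2_norm_eq_inner
        flip: scaleR_conv_of_real)
  have "Re (trace (diagonal (\<lambda>x. (magnetization x)\<^sup>2) ** \<rho>)) \<le> Re (trace (diagonal (\<lambda>x. N) ** \<rho>))"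
    using assms
    by (rule psd_trace_mono)
      (unfold inner_diagonal N_def, intro sum_mono mult_right_mono magnetization_sq_le zero_le_power2)
  also have "\<dots> = N * Re (trace \<rho>)"
    by (simp add: trace_diagonal_mult trace_def[of \<rho>] flip: sum_distrib_left)
  finally show ?thesis by (simp add: N_def)
qed

text \<open>The all-ones string already contributes. Strictness here gives the strict conclusion
  even when T equals its lower bound.\<close>

lemma trace_magnetization_sq_maximally_mixed_pos:
  "0 < Re (trace (diagonal (\<lambda>x. (magnetization x)\<^sup>2) ** (maximally_mixed :: ('n::finite) operator)))"
proof -
  have "magnetization (\<lambda>k::'n. True) = real CARD('n) / 2" by (simp add: magnetization_def)
  then have "0 < magnetization (\<lambda>k::'n. True)" by (metis half_gt_zero of_nat_0_less_iff zero_less_card_finite)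
  then have "0 < (magnetization (\<lambda>k::'n. True))\<^sup>2" by simp
  then have "0 < (\<Sum>x\<in>UNIV. (magnetization (x :: 'n \<Rightarrow> bool))\<^sup>2)"
    by (intro sum_pos2[where i = "\<lambda>k. True"]) auto
  then show ?thesis
    by (simp add: trace_diagonal_mult maximally_mixed_def mat_def flip: sum_divide_distrib)
qed

lemma trace_maximally_mixed: "trace (maximally_mixed :: ('n::finite) operator) = 1"
  by (simp add: trace_def maximally_mixed_def mat_def card_fun
      scaleR_conv_of_real[where 'a = complex])

theorem mainTheorem3:
  fixes i j :: "nat \<Rightarrow> 'n::finite"
    and a b :: "nat \<Rightarrow> complex"
    and L T :: nat
    and \<epsilon> p :: real
    and \<Pi>\<^sub>0 :: "'n operator"
  assumes "CARD('n) \<ge> 2"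
    and "L \<ge> 1"
    and "\<And>\<alpha>. \<alpha> \<in> {1..L} \<Longrightarrow> i \<alpha> \<noteq> j \<alpha>"
    and "\<And>\<alpha>. \<alpha> \<in> {1..L} \<Longrightarrow> (cmod (a \<alpha>))\<^sup>2 + (cmod (b \<alpha>))\<^sup>2 = 1"
    and "smallest_nonzero_eigenvalue (hamiltonian L i j a b) \<epsilon>"
    and "orthogonal_projector_onto \<Pi>\<^sub>0 (mat_kernel (hamiltonian L i j a b))"
    and "0 \<le> p" and "p < 1"
    and "real T \<ge> (real CARD('n))\<^sup>2 * real L / (2 * (1 - p) * \<epsilon>)"
  shows "trace (\<Pi>\<^sub>0 ** (average_channel L i j a b ^^ T) maximally_mixed) \<in> \<real> \<and>
         Re (trace (\<Pi>\<^sub>0 ** (average_channel L i j a b ^^ T) maximally_mixed)) > p"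
proof
  define \<rho> where "\<rho> t = (average_channel L i j a b ^^ t) maximally_mixed" for t
  define q where "q t = Re (trace (\<Pi>\<^sub>0 ** \<rho> t))" for t
  define D where "D t = Re (trace (diagonal (\<lambda>x. (magnetization x)\<^sup>2) ** \<rho> t))" for t
  \<comment> \<open>Least growth of \<open>D\<close> in one step while the ground space weight is at
    most \<open>p\<close>.\<close>
  define c where "c = \<epsilon> * (1 - p) / (2 * real L)"
  have \<rho>_Suc: "\<rho> (Suc t) = average_channel L i j a b (\<rho> t)" for t by (simp add: \<rho>_def)
  have psd: "psd (\<rho> t)" for t
    by (induction t) (simp_all add: \<rho>_def psd_maximally_mixed psd_average_channel)
  have tr: "trace (\<rho> t) = 1" for t
  proof (induction t)
    case 0
    show ?case by (simp add: \<rho>_def trace_maximally_mixed)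
  next
    case (Suc t)
    then show ?case
      using trace_average_channel_preserving[where i = i and j = j and a = a and b = b and 
        \<rho> = "\<rho> t", OF assms(2-4)] by (simp add: \<rho>_Suc)
  qed
  have "\<epsilon> > 0" by (rule smallest_nonzero_eigenvalue_hamiltonian_pos[OF assms(3-5)])
  have "incseq q"
    by (rule incseq_SucI)
      (unfold q_def \<rho>_Suc, rule trace_projector_average_channel_mono[OF assms(2-4,6) psd])
  show "trace (\<Pi>\<^sub>0 ** (average_channel L i j a b ^^ T) maximally_mixed) \<in> \<real>"
    using assms(6) psd_hermitian[OF psd]
    by (auto simp: orthogonal_projector_onto_def simp flip: \<rho>_def
        intro!: trace_mult_hermitian_real)
  show "p < Re (trace (\<Pi>\<^sub>0 ** (average_channel L i j a b ^^ T) maximally_mixed))"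
  proof (rule ccontr)
    assume "\<not> ?thesis"
    then have "q T \<le> p" by (simp add: q_def \<rho>_def)
    \<comment> \<open>Monotonicity of \<open>q\<close> carries the failure at time T back to every
      earlier time, so the energy is at least \<open>\<epsilon> * (1 - p)\<close>
      throughout.\<close>
    have growth: "D t + c \<le> D (Suc t)" if "t \<le> T" for t
    proof -
      have "q t \<le> p" using incseqD[OF \<open>incseq q\<close> that] \<open>q T \<le> p\<close> by simp
      then have "\<epsilon> * (1 - p) \<le> \<epsilon> * (1 - q t)" using \<open>\<epsilon> > 0\<close> by simp
      also have "\<dots> \<le> Re (trace (hamiltonian L i j a b ** \<rho> t))"
        using hamiltonian_gap_trace[OF assms(5,6) psd[of t]] by (simp add: tr q_def)
      finally have "c \<le> Re (trace (hamiltonian L i j a b ** \<rho> t)) / (2 * real L)"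
        unfolding c_def by (rule divide_right_mono) simp
      then show ?thesis
        using trace_magnetization_average_channel[where i = i and j = j and a = a and b = b and 
          \<rho> = "\<rho> t", OF assms(2-4)]
        by (simp add: D_def \<rho>_Suc)
    qed
    have "D 0 + real t * c \<le> D t" if "t \<le> T" for t
      using that
    proof (induction t)
      case (Suc t)
      then show ?case using growth[of t] by (simp add: distrib_right)
    qed simp
    then have "D 0 + real T * c \<le> D T" by simp
    moreover have "D 0 > 0"
      using trace_magnetization_sq_maximally_mixed_pos by (simp add: D_def \<rho>_def)
    moreover have "D T \<le> (real CARD('n))\<^sup>2 / 4"
      using trace_magnetization_sq_le[OF psd[of T]] by (simp add: D_def tr)
    \<comment> \<open>The assumed bound on T, rearranged: by then the accumulated growth alone fills
      the whole range of the second moment.\<close>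
    moreover have "(real CARD('n))\<^sup>2 / 4 \<le> real T * c"
      using assms(2,8,9) \<open>\<epsilon> > 0\<close> by (simp add: c_def field_simps)
    ultimately show False by linarith
  qed
qed

end
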